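(* Let $D=(V+r,E)$ be a finite directed graph with root node $r\notin V$, and let $t\in V$ be a sink of $D$ (that is, no edge of $D$ leaves $t$). Then an edge set $F\subseteq E$ is a maximal flame in $D$ if and only if $F$ is the disjoint union of a maximal flame in $D-t$ (with root $r$) and a base of the matroid $\mathcal{G}_D(t)$.
   Context: For a directed graph $H$ with root $r$ and vertex $v\neq r$, $\lambda_H(r,v)$ denotes the maximum number of pairwise edge-disjoint directed paths from $r$ to $v$ in $H$, and $\varrho_H(v)$ the in-degree of $v$ in $H$. Spanning subgraphs are identified with their edge sets. A rooted digraph $F=(V+r,E_F)$ is a flame if $\lambda_F(r,v)=\varrho_F(v)$ for every $v\in V$. A maximal flame in $D=(V+r,E)$ is an edge set $F\subseteq E$ such that the spanning subgraph $(V+r,F)$ satisfies $\lambda_D(r,v)=\lambda_F(r,v)=\varrho_F(v)$ for every $v\in V$. For $v\in V$, $\mathcal{G}_D(v)$ is the matroid whose ground set is $\operatorname{in}_D(v)$, the set of edges of $D$ entering $v$, in which a subset $X\subseteq\operatorname{in}_D(v)$ is independent if and only if there exist $|X|$ pairwise edge-disjoint directed paths from $r$ to $v$ in $D$ whose last edges form exactly $X$. $D-t$ denotes the digraph obtained by deleting $t$ and its incident edges. *)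

theory Defs
  imports "Graph_Theory.Digraph" "Graph_Theory.Arc_Walk"
begin

(* Paths are arc lists, so parallel arcs are distinguished. For u = v the empty path is
   admitted; the notions below are only used with distinct end vertices. *)
definition edge_disjoint_paths ::
    "('a, 'b) pre_digraph \<Rightarrow> 'a \<Rightarrow> 'a \<Rightarrow> 'b list set \<Rightarrow> bool" where
  "edge_disjoint_paths H u v P \<longleftrightarrow>
     finite P \<and> (\<forall>p\<in>P. pre_digraph.apath H u p v) \<and>
     (\<forall>p\<in>P. \<forall>q\<in>P. p \<noteq> q \<longrightarrow> set p \<inter> set q = {})"

definition local_edge_connectivity :: "('a, 'b) pre_digraph \<Rightarrow> 'a \<Rightarrow> 'a \<Rightarrow> nat" where
  "local_edge_connectivity H r v = Max {card P | P. edge_disjoint_paths H r v P}"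

definition spanning_sub :: "('a, 'b) pre_digraph \<Rightarrow> 'b set \<Rightarrow> ('a, 'b) pre_digraph" where
  "spanning_sub D F = D\<lparr>arcs := F\<rparr>"

definition maximal_flame :: "('a, 'b) pre_digraph \<Rightarrow> 'a \<Rightarrow> 'b set \<Rightarrow> bool" where
  "maximal_flame D r F \<longleftrightarrow>
     F \<subseteq> arcs D \<and>
     (\<forall>v\<in>verts D - {r}.
        local_edge_connectivity D r v = local_edge_connectivity (spanning_sub D F) r v \<and>
        local_edge_connectivity (spanning_sub D F) r v = in_degree (spanning_sub D F) v)"

(* The independent sets of the matroid of D at v, whose ground set is in_arcs D v. *)
definition path_matroid_indep :: "('a, 'b) pre_digraph \<Rightarrow> 'a \<Rightarrow> 'a \<Rightarrow> 'b set set" where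
  "path_matroid_indep D r v =
     {X. X \<subseteq> in_arcs D v \<and>
         (\<exists>P. edge_disjoint_paths D r v P \<and> card P = card X \<and> last ` P = X)}"

(* Bases of a matroid given by its family of independent sets. *)
definition base_of :: "'b set set \<Rightarrow> 'b set \<Rightarrow> bool" where
  "base_of I B \<longleftrightarrow> B \<in> I \<and> (\<forall>X\<in>I. B \<subseteq> X \<longrightarrow> X = B)"

end

theory Submission
  imports Defs
begin

text \<open>Everything away from \<open>t\<close> is the same in \<open>D\<close> and \<open>D - t\<close>, so the point is that a base \<open>B\<close> of the
  matroid at \<open>t\<close> remains linked to \<open>r\<close> when \<open>D - t\<close> is thinned out to a maximal flame \<open>F'\<close>. By
  Menger's theorem this is a statement about cuts. By submodularity, every vertex set avoiding \<open>r\<close>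
  can be enlarged so that its in-degree in \<open>D - t\<close> is at most the in-degree of the original set
  in \<open>F'\<close>; hence a cut of size less than \<open>card B\<close> in \<open>F' \<union> B\<close> would give one in \<open>(D - t) \<union> B\<close>.
  Uncrossing tight cuts also shows that all bases have size \<open>\<lambda>(r,t)\<close>.\<close>

section \<open>Cuts\<close>

text \<open>The arc set \<open>S\<close> is a separate argument so that cuts of different subgraphs
  can be compared over the same \<open>head\<close> and \<open>tail\<close>.\<close>

definition cut_arcs :: "('a, 'b) pre_digraph \<Rightarrow> 'b set \<Rightarrow> 'a set \<Rightarrow> 'b set" where
  "cut_arcs G S X = {e \<in> S. head G e \<in> X \<and> tail G e \<notin> X}"

lemma finite_cut_arcs [simp]: "finite S \<Longrightarrow> finite (cut_arcs G S X)"
  by (simp add: cut_arcs_def)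

text \<open>The inequality holds arc by arc; only arcs joining \<open>X - Y\<close> and
  \<open>Y - X\<close>, in either direction, make it strict.\<close>

lemma card_cut_arcs_submodular:
  assumes "finite S"
  shows "card (cut_arcs G S (X \<inter> Y)) + card (cut_arcs G S (X \<union> Y))
    \<le> card (cut_arcs G S X) + card (cut_arcs G S Y)"
proof -
  have c: "card (cut_arcs G S Z) = (\<Sum>e\<in>S. of_bool (head G e \<in> Z \<and> tail G e \<notin> Z))" for Z
    using assms by (simp add: cut_arcs_def Int_def)
  show ?thesis
    unfolding c sum.distrib[symmetric] by (rule sum_mono) auto
qed

lemma card_cut_arcs_mono:
  "finite T \<Longrightarrow> S \<subseteq> T \<Longrightarrow> card (cut_arcs G S X) \<le> card (cut_arcs G T X)"
  by (rule card_mono) (auto simp: cut_arcs_def)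

lemma card_cut_arcs_insert:
  assumes "finite S" "e \<notin> S"
  shows "card (cut_arcs G (insert e S) X)
    = card (cut_arcs G S X) + of_bool (head G e \<in> X \<and> tail G e \<notin> X)"
proof -
  have "cut_arcs G (insert e S) X
      = (if head G e \<in> X \<and> tail G e \<notin> X then insert e (cut_arcs G S X) else cut_arcs G S X)"
    by (auto simp: cut_arcs_def)
  moreover have "e \<notin> cut_arcs G S X"
    using assms by (simp add: cut_arcs_def)
  ultimately show ?thesis
    using assms by simp
qed

section \<open>Menger's theorem\<close>

text \<open>Call \<open>X\<close> tight if equality holds in the cut condition; the whole vertex set is tight, and tight
  sets are closed under intersection. A source \<open>v \<noteq> t\<close> can be moved along any arc into \<open>M - {v}\<close>, where
  \<open>M\<close> is the least tight set containing \<open>v\<close>, and such an arc exists because \<open>M - {v}\<close> itself satisfies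
  the cut condition but has fewer sources than \<open>M\<close>.\<close>

lemma (in fin_digraph) walk_packing:
  fixes s :: "'i \<Rightarrow> 'a"
  assumes "finite I" "S \<subseteq> arcs G" "\<And>i. i \<in> I \<Longrightarrow> s i \<in> verts G" "t \<in> verts G"
    and "\<And>X. X \<subseteq> verts G \<Longrightarrow> t \<in> X \<Longrightarrow> card I \<le> card (cut_arcs G S X) + card {i\<in>I. s i \<in> X}"
  shows "\<exists>p. (\<forall>i\<in>I. cas (s i) (p i) t \<and> set (p i) \<subseteq> S) \<and>
    (\<forall>i\<in>I. \<forall>j\<in>I. i \<noteq> j \<longrightarrow> set (p i) \<inter> set (p j) = {})"
  using assms(2,3,5)
proof (induction "card S" arbitrary: S s rule: less_induct)
  case less
  note cut = less.prems(3)
  have finS: "finite S"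
    by (rule finite_subset[OF less.prems(1) finite_arcs])
  show ?case
  proof (cases "\<forall>i\<in>I. s i = t")
    case True
    then show ?thesis by (intro exI[of _ "\<lambda>_. []"]) auto
  next
    case False
    then obtain i where i: "i \<in> I" "s i \<noteq> t" by blast
    \<comment> \<open>A walk to \<open>t\<close> that starts outside a set \<open>X\<close>
      containing \<open>t\<close> must enter \<open>X\<close>, so \<open>f X\<close> bounds the
      number of disjoint walks.\<close>
    define f where "f X = card (cut_arcs G S X) + card {i\<in>I. s i \<in> X}" for X
    \<comment> \<open>An inequality suffices here, since the cut condition supplies its converse.
      Requiring \<open>s i\<close> in \<open>X\<close> makes the least tight set one around the
      source to be moved.\<close>
    define tight where "tight X \<longleftrightarrow> X \<subseteq> verts G \<and> t \<in> X \<and> s i \<in> X \<and> f X \<le> card I" for X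
    have f_submod: "f (X \<inter> Y) + f (X \<union> Y) \<le> f X + f Y" for X Y
    proof -
      have "card {i\<in>I. s i \<in> X \<inter> Y} + card {i\<in>I. s i \<in> X \<union> Y}
          = card ({i\<in>I. s i \<in> X} \<union> {i\<in>I. s i \<in> Y}) + card ({i\<in>I. s i \<in> X} \<inter> {i\<in>I. s i \<in> Y})"
        by (subst add.commute) (auto intro!: arg_cong2[of _ _ _ _ "(+)"] arg_cong[of _ _ card])
      also have "\<dots> = card {i\<in>I. s i \<in> X} + card {i\<in>I. s i \<in> Y}"
        using assms(1) by (intro card_Un_Int[symmetric]) auto
      finally show ?thesis
        using card_cut_arcs_submodular[OF finS, of G X Y] unfolding f_def by linarith
    qed
    have tight_Int: "tight (X \<inter> Y)" if "tight X" "tight Y" for X Y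
    proof -
      have "card I \<le> f (X \<union> Y)"
        using cut[of "X \<union> Y"] that unfolding f_def tight_def by blast
      then show ?thesis
        using f_submod[of X Y] that unfolding tight_def by auto
    qed
    have "cut_arcs G S (verts G) = {}"
      using less.prems(1) by (auto simp: cut_arcs_def)
    then have "f (verts G) \<le> card I"
      unfolding f_def using assms(1) by (simp add: card_mono)
    then have "tight (verts G)"
      unfolding tight_def using less.prems(2) i assms(4) by auto
    then obtain M where M: "tight M" and M_min: "\<And>Y. tight Y \<Longrightarrow> card M \<le> card Y"
      using arg_min_nat_lemma[of tight _ card] by blast
    have finM: "finite M"
      using M finite_subset[OF _ finite_verts] unfolding tight_def by blast
    have M_least: "M \<subseteq> Y" if "tight Y" for Y
      using card_seteq[OF finM, of "M \<inter> Y"] M_min[OF tight_Int[OF M that]] by blast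
    have "card I \<le> f (M - {s i})"
      unfolding f_def by (rule cut) (use M i in \<open>auto simp: tight_def\<close>)
    moreover have "card {j\<in>I. s j \<in> M - {s i}} < card {j\<in>I. s j \<in> M}"
      using i M assms(1) by (intro psubset_card_mono) (auto simp: tight_def)
    ultimately have "card (cut_arcs G S M) < card (cut_arcs G S (M - {s i}))"
      using M unfolding f_def tight_def by linarith
    \<comment> \<open>An arc that enters \<open>M - {s i}\<close> but not \<open>M\<close> can only
      start at \<open>s i\<close>.\<close>
    then have "\<not> cut_arcs G S (M - {s i}) \<subseteq> cut_arcs G S M"
      using card_mono[OF finite_cut_arcs[OF finS], of _ G M] by (meson linorder_not_le)
    then obtain e where e: "e \<in> S" "tail G e = s i" "head G e \<in> M" "head G e \<noteq> s i"
      by (auto simp: cut_arcs_def)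
    define s' where "s' = s(i := head G e)"
    have S: "S = insert e (S - {e})" using e by blast
    \<comment> \<open>Moving source \<open>i\<close> along \<open>e\<close> and deleting
      \<open>e\<close> lowers \<open>f X\<close> only if \<open>s i\<close> is in \<open>X\<close>
      and the head of \<open>e\<close> is not, and then by one. Such an \<open>X\<close> has a unit
      to spare: if tight, it would contain \<open>M\<close> and hence the head of
      \<open>e\<close>.\<close>
    have "card I \<le> card (cut_arcs G (S - {e}) X) + card {j\<in>I. s' j \<in> X}"
      if X: "X \<subseteq> verts G" "t \<in> X" for X
    proof -
      have cutS: "card (cut_arcs G S X)
          = card (cut_arcs G (S - {e}) X) + of_bool (head G e \<in> X \<and> tail G e \<notin> X)"
        using card_cut_arcs_insert[of "S - {e}" e G X] finS S by simp
      have src: "card {j\<in>I. q j \<in> X} = card {j\<in>I - {i}. q j \<in> X} + of_bool (q i \<in> X)" for q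
      proof -
        have "{j\<in>I. q j \<in> X} = (if q i \<in> X then insert i {j\<in>I - {i}. q j \<in> X} else {j\<in>I - {i}. q j \<in> X})"
          using i by auto
        then show ?thesis using assms(1) by simp
      qed
      have eq: "{j\<in>I - {i}. s' j \<in> X} = {j\<in>I - {i}. s j \<in> X}"
        unfolding s'_def by auto
      have s'i: "s' i = head G e"
        by (simp add: s'_def)
      have "card I \<le> f X"
        using cut X unfolding f_def by blast
      moreover have "card I < f X" if "s i \<in> X" "head G e \<notin> X"
      proof (rule ccontr)
        assume "\<not> card I < f X"
        then have "M \<subseteq> X"
          using that(1) X by (intro M_least) (simp add: tight_def)
        then show False using that(2) e(3) by blast
      qed
      ultimately show ?thesis
        using e(2) unfolding f_def cutS src[of s] src[of s'] eq s'i
        by (cases "s i \<in> X"; cases "head G e \<in> X") auto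
    qed
    moreover have "card (S - {e}) < card S"
      using e finS by (intro psubset_card_mono) auto
    moreover have "s' j \<in> verts G" if "j \<in> I" for j
      using that less.prems(1,2) e unfolding s'_def by auto
    moreover have "S - {e} \<subseteq> arcs G"
      using less.prems(1) by blast
    ultimately have "\<exists>p. (\<forall>i\<in>I. cas (s' i) (p i) t \<and> set (p i) \<subseteq> S - {e}) \<and>
        (\<forall>i\<in>I. \<forall>j\<in>I. i \<noteq> j \<longrightarrow> set (p i) \<inter> set (p j) = {})"
      by (intro less.hyps) blast+
    then obtain p where p: "\<forall>i\<in>I. cas (s' i) (p i) t \<and> set (p i) \<subseteq> S - {e}"
        "\<forall>i\<in>I. \<forall>j\<in>I. i \<noteq> j \<longrightarrow> set (p i) \<inter> set (p j) = {}"
      by blast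
    show ?thesis
    proof (intro exI[of _ "p(i := e # p i)"] conjI ballI impI)
      fix j assume "j \<in> I"
      then show "cas (s j) ((p(i := e # p i)) j) t" "set ((p(i := e # p i)) j) \<subseteq> S"
        using p(1) e unfolding s'_def by (auto split: if_splits)
    next
      fix j k assume jk: "j \<in> I" "k \<in> I" "j \<noteq> k"
      then have "set (p j) \<inter> set (p k) = {}" "e \<notin> set (p j)" "e \<notin> set (p k)"
        using p by auto
      then show "set ((p(i := e # p i)) j) \<inter> set ((p(i := e # p i)) k) = {}"
        using jk by auto
    qed
  qed
qed

section \<open>Edge-disjoint paths against cuts\<close>

lemma (in fin_digraph) cas_meets_cut:
  assumes "cas u p v" "u \<notin> X" "v \<in> X" "set p \<subseteq> S"
  shows "set p \<inter> cut_arcs G S X \<noteq> {}"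
  using assms by (induction p arbitrary: u) (auto simp: cut_arcs_def)

text \<open>The easy half of Menger's theorem: every path has an arc entering \<open>X\<close>, and
  disjointness makes the choice of one such arc per path injective.\<close>

lemma (in fin_digraph) card_edge_disjoint_paths_le_cut:
  assumes "edge_disjoint_paths G u v P" "u \<notin> X" "v \<in> X"
  shows "card P \<le> card (cut_arcs G (arcs G) X)"
proof -
  have "\<forall>p\<in>P. \<exists>e. e \<in> set p \<inter> cut_arcs G (arcs G) X"
  proof
    fix p assume "p \<in> P"
    then have "cas u p v" "set p \<subseteq> arcs G"
      using assms(1) unfolding edge_disjoint_paths_def apath_def awalk_def by auto
    then show "\<exists>e. e \<in> set p \<inter> cut_arcs G (arcs G) X"
      using cas_meets_cut assms(2,3) by blast
  qed
  then obtain e where e: "\<And>p. p \<in> P \<Longrightarrow> e p \<in> set p \<inter> cut_arcs G (arcs G) X"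
    by metis
  have "inj_on e P"
  proof (rule inj_onI)
    fix p q assume pq: "p \<in> P" "q \<in> P" "e p = e q"
    then have "e p \<in> set p \<inter> set q"
      using e[of p] e[of q] by simp
    then show "p = q"
      using assms(1) pq(1,2) unfolding edge_disjoint_paths_def by blast
  qed
  then show ?thesis
    using e by (intro card_inj_on_le) auto
qed

text \<open>Makes the \<open>Max\<close> in the definition of connectivity a true maximum; there are
  only finitely many paths without repeated vertices.\<close>

lemma (in fin_digraph) finite_card_edge_disjoint_paths:
  "finite {card P | P. edge_disjoint_paths G u v P}"
proof -
  have "{card P | P. edge_disjoint_paths G u v P} \<subseteq> card ` Pow {p. apath u p v}"
    by (auto simp: edge_disjoint_paths_def)
  then show ?thesis
    by (rule finite_subset) (simp add: apaths_finite)
qed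

lemma (in fin_digraph) local_edge_connectivity_attained:
  obtains P where "edge_disjoint_paths G u v P" "card P = local_edge_connectivity G u v"
proof -
  have "edge_disjoint_paths G u v {}"
    by (simp add: edge_disjoint_paths_def)
  then have "local_edge_connectivity G u v \<in> {card P | P. edge_disjoint_paths G u v P}"
    unfolding local_edge_connectivity_def
    by (intro Max_in finite_card_edge_disjoint_paths) blast
  then show thesis using that by force
qed

lemma (in fin_digraph) card_le_local_edge_connectivity:
  "edge_disjoint_paths G u v P \<Longrightarrow> card P \<le> local_edge_connectivity G u v"
  unfolding local_edge_connectivity_def
  by (intro Max_ge finite_card_edge_disjoint_paths) blast

text \<open>The threshold \<open>k\<close> stands in for a minimum over cuts, so that connectivities
  of two graphs can be compared cut by cut.\<close>

lemma (in fin_digraph) menger: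
  assumes "u \<in> verts G" "v \<in> verts G" "u \<noteq> v"
  shows "k \<le> local_edge_connectivity G u v \<longleftrightarrow>
    (\<forall>X\<subseteq>verts G. v \<in> X \<longrightarrow> u \<notin> X \<longrightarrow> k \<le> card (cut_arcs G (arcs G) X))"
proof
  assume k: "k \<le> local_edge_connectivity G u v"
  obtain P where "edge_disjoint_paths G u v P" "card P = local_edge_connectivity G u v"
    by (rule local_edge_connectivity_attained)
  then show "\<forall>X\<subseteq>verts G. v \<in> X \<longrightarrow> u \<notin> X \<longrightarrow> k \<le> card (cut_arcs G (arcs G) X)"
    using k card_edge_disjoint_paths_le_cut le_trans by metis
next
  assume cut: "\<forall>X\<subseteq>verts G. v \<in> X \<longrightarrow> u \<notin> X \<longrightarrow> k \<le> card (cut_arcs G (arcs G) X)"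
  \<comment> \<open>All \<open>k\<close> walks start at \<open>u\<close>, so a set containing
    \<open>u\<close> satisfies the condition through its sources alone.\<close>
  have "card {..<k} \<le> card (cut_arcs G (arcs G) X) + card {i\<in>{..<k}. u \<in> X}"
    if "X \<subseteq> verts G" "v \<in> X" for X
    using cut that by (cases "u \<in> X") auto
  then obtain p where p: "\<forall>i\<in>{..<k}. cas u (p i) v \<and> set (p i) \<subseteq> arcs G"
      "\<forall>i\<in>{..<k}. \<forall>j\<in>{..<k}. i \<noteq> j \<longrightarrow> set (p i) \<inter> set (p j) = {}"
    using walk_packing[of "{..<k}" "arcs G" "\<lambda>_. u" v] assms by auto
  define q where "q i = awalk_to_apath (p i)" for i
  have q: "apath u (q i) v" "set (q i) \<subseteq> set (p i)" if "i < k" for i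
  proof -
    have "awalk u (p i) v"
      using p(1) that assms(1) unfolding awalk_def by simp
    then show "apath u (q i) v" "set (q i) \<subseteq> set (p i)"
      unfolding q_def by (rule apath_awalk_to_apath, rule awalk_to_apath_subset)
  qed
  \<comment> \<open>Disjoint arc sets distinguish two paths only if these are nonempty; this is
    where \<open>u\<close> and \<open>v\<close> being distinct matters.\<close>
  have ne: "q i \<noteq> []" if "i < k" for i
    using q(1)[OF that] assms(3) by (auto simp: apath_Nil_iff)
  have disj: "set (q i) \<inter> set (q j) = {}" if "i < k" "j < k" "i \<noteq> j" for i j
    using p(2) q(2) that by (metis (no_types) disjoint_iff lessThan_iff subsetD)
  have inj: "inj_on q {..<k}"
    using disj ne by (metis (no_types) Int_absorb inj_onI lessThan_iff set_empty2)
  have "edge_disjoint_paths G u v (q ` {..<k})"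
    unfolding edge_disjoint_paths_def using q(1) disj by fastforce
  then have "card (q ` {..<k}) \<le> local_edge_connectivity G u v"
    by (rule card_le_local_edge_connectivity)
  then show "k \<le> local_edge_connectivity G u v"
    using inj by (simp add: card_image)
qed

section \<open>Spanning subgraphs\<close>

lemma spanning_sub_simps [simp]:
  "verts (spanning_sub G F) = verts G" "arcs (spanning_sub G F) = F"
  "tail (spanning_sub G F) = tail G" "head (spanning_sub G F) = head G"
  by (simp_all add: spanning_sub_def)

lemma spanning_sub_arcs [simp]: "spanning_sub G (arcs G) = G"
  by (simp add: spanning_sub_def)

lemma cut_arcs_spanning_sub [simp]: "cut_arcs (spanning_sub G F) = cut_arcs G"
  by (simp add: cut_arcs_def fun_eq_iff)

lemma in_degree_spanning_sub: "in_degree (spanning_sub G F) v = card {e \<in> F. head G e = v}"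
  by (simp add: in_degree_def in_arcs_def)

lemma cas_spanning_sub: "pre_digraph.cas (spanning_sub G F) u p v = pre_digraph.cas G u p v"
  by (induction p arbitrary: u) (simp_all add: pre_digraph.cas.simps)

lemma awalk_verts_spanning_sub:
  "pre_digraph.awalk_verts (spanning_sub G F) u p = pre_digraph.awalk_verts G u p"
  by (induction p arbitrary: u) (simp_all add: pre_digraph.awalk_verts.simps)

lemma apath_spanning_sub:
  assumes "F \<subseteq> arcs G"
  shows "pre_digraph.apath (spanning_sub G F) u p v \<longleftrightarrow> pre_digraph.apath G u p v \<and> set p \<subseteq> F"
  using assms
  by (auto simp: pre_digraph.apath_def pre_digraph.awalk_def cas_spanning_sub awalk_verts_spanning_sub)

context fin_digraph
begin

lemma fin_digraph_spanning_sub: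
  assumes "F \<subseteq> arcs G"
  shows "fin_digraph (spanning_sub G F)"
  using assms finite_subset[OF assms] by unfold_locales auto

lemma menger_spanning_sub:
  assumes "F \<subseteq> arcs G" "u \<in> verts G" "v \<in> verts G" "u \<noteq> v"
  shows "k \<le> local_edge_connectivity (spanning_sub G F) u v \<longleftrightarrow>
    (\<forall>X\<subseteq>verts G. v \<in> X \<longrightarrow> u \<notin> X \<longrightarrow> k \<le> card (cut_arcs G F X))"
  using fin_digraph.menger[OF fin_digraph_spanning_sub[OF assms(1)]] assms by simp

text \<open>Adding arcs can only enlarge cuts, so the claim follows from the cut characterisation
  without transferring path families.\<close>

lemma local_edge_connectivity_mono:
  assumes "F \<subseteq> F'" "F' \<subseteq> arcs G" "u \<in> verts G" "v \<in> verts G" "u \<noteq> v"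
  shows "local_edge_connectivity (spanning_sub G F) u v
    \<le> local_edge_connectivity (spanning_sub G F') u v"
proof -
  have "card (cut_arcs G F X) \<le> card (cut_arcs G F' X)" for X
    by (rule card_cut_arcs_mono[OF finite_subset[OF assms(2) finite_arcs] assms(1)])
  moreover have "F \<subseteq> arcs G" using assms by blast
  ultimately show ?thesis
    using menger_spanning_sub assms le_refl le_trans by meson
qed

text \<open>Among the supersets of \<open>X\<close> with no larger in-degree in \<open>F\<close>, a largest one is entered by no arc
  \<open>e\<close> outside \<open>F\<close>: otherwise it could be enlarged by a minimum cut of \<open>F + e\<close> for the head of \<open>e\<close>,
  which has to contain both ends of \<open>e\<close>.\<close>

lemma cut_of_connectivity_preserving_subgraph:
  assumes r: "r \<in> verts G" and F: "F \<subseteq> arcs G"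
    and pres: "\<And>v. v \<in> verts G - {r} \<Longrightarrow>
      local_edge_connectivity G r v = local_edge_connectivity (spanning_sub G F) r v"
    and X: "X \<subseteq> verts G - {r}"
  obtains Z where "X \<subseteq> Z" "Z \<subseteq> verts G - {r}"
    "card (cut_arcs G (arcs G) Z) \<le> card (cut_arcs G F X)"
proof -
  let ?d = "\<lambda>Z. card (cut_arcs G F Z)"
  have finF: "finite F"
    by (rule finite_subset[OF F finite_arcs])
  define Q where "Q Z \<longleftrightarrow> X \<subseteq> Z \<and> Z \<subseteq> verts G - {r} \<and> ?d Z \<le> ?d X" for Z
  have "Q X" using X by (simp add: Q_def)
  moreover have "\<forall>Z. Q Z \<longrightarrow> card Z < Suc (card (verts G))"
    unfolding Q_def by (meson Diff_subset card_mono finite_verts le_imp_less_Suc subset_trans)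
  ultimately obtain Z where Z: "Q Z" and Z_max: "\<And>Y. Q Y \<Longrightarrow> card Y \<le> card Z"
    using ex_has_greatest_nat[of Q X card] by blast
  have "cut_arcs G (arcs G) Z \<subseteq> cut_arcs G F Z"
  proof (rule ccontr)
    assume "\<not> ?thesis"
    then obtain e where e: "e \<in> arcs G" "e \<notin> F" "head G e \<in> Z" "tail G e \<notin> Z"
      by (auto simp: cut_arcs_def)
    let ?b = "head G e"
    define k where "k = local_edge_connectivity G r ?b"
    have b: "?b \<in> verts G" "r \<noteq> ?b"
      using e Z by (auto simp: Q_def)
    have Fe: "insert e F \<subseteq> arcs G"
      using F e by blast
    have kF: "k \<le> ?d W" if "W \<subseteq> verts G" "?b \<in> W" "r \<notin> W" for W
      using menger_spanning_sub[OF F r b, of k] pres[of ?b] b that unfolding k_def by auto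
    \<comment> \<open>Even \<open>G\<close> has connectivity only \<open>k\<close> at the head of
      \<open>e\<close>, so \<open>F\<close> with \<open>e\<close> added cannot reach
      \<open>k + 1\<close>.\<close>
    have "\<not> Suc k \<le> local_edge_connectivity (spanning_sub G (insert e F)) r ?b"
      using local_edge_connectivity_mono[OF Fe subset_refl r b] unfolding k_def by simp
    then obtain W where W: "W \<subseteq> verts G" "?b \<in> W" "r \<notin> W"
        "card (cut_arcs G (insert e F) W) \<le> k"
      using menger_spanning_sub[OF Fe r b, of "Suc k"] by (metis not_less_eq_eq)
    \<comment> \<open>If \<open>e\<close> entered \<open>W\<close>, fewer than \<open>k\<close> arcs
      of \<open>F\<close> would enter \<open>W\<close>, against \<open>kF\<close>.\<close>
    have dW: "?d W \<le> k" "tail G e \<in> W"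
      using card_cut_arcs_insert[OF finF e(2), of G W] W kF[of W]
      by (cases "tail G e \<in> W"; auto)+
    \<comment> \<open>The intersection still contains the head of \<open>e\<close>, so it absorbs
      the \<open>k\<close> contributed by \<open>W\<close> in the submodular inequality.\<close>
    have "k \<le> ?d (W \<inter> Z)"
      using W e(3) by (intro kF) auto
    then have "?d (W \<union> Z) \<le> ?d Z"
      using card_cut_arcs_submodular[OF finF, of G W Z] dW(1) by linarith
    then have "Q (W \<union> Z)"
      using Z W unfolding Q_def by auto
    moreover have "card Z < card (W \<union> Z)"
      using dW(2) e(4) W(1) Z by (intro psubset_card_mono) (auto simp: Q_def intro: finite_subset)
    ultimately show False
      using Z_max by fastforce
  qed
  then have "card (cut_arcs G (arcs G) Z) \<le> ?d X"
    using Z card_mono[OF finite_cut_arcs[OF finF]] le_trans unfolding Q_def by metis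
  then show thesis
    using that Z unfolding Q_def by blast
qed

section \<open>The path matroid\<close>

text \<open>No vertex is repeated on the path, so the heads of its arcs are distinct and exactly one
  arc enters \<open>v\<close>.\<close>

lemma apath_head_iff_last:
  assumes "apath u p v" "p \<noteq> []" "e \<in> set p"
  shows "head G e = v \<longleftrightarrow> e = last p"
proof -
  have "cas u p v" "distinct (awalk_verts u p)"
    using assms(1) by (auto simp: apath_def awalk_def)
  then have "distinct (map (head G) p)"
    using assms(2) by (simp add: awalk_verts_conv')
  then have inj: "inj_on (head G) (set p)"
    by (simp add: distinct_map)
  have "awlast u p = v"
    using \<open>cas u p v\<close> by (rule awlast_if_cas)
  then have "head G (last p) = v"
    using assms(2) by (simp add: awalk_verts_conv)
  then show ?thesis
    using inj_on_eq_iff[OF inj assms(3) last_in_set[OF assms(2)]] by simp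
qed

text \<open>Turns independence into a condition on cuts. A path to \<open>v\<close> uses exactly one
  arc entering \<open>v\<close>, its last; so disjoint paths in the graph where only
  \<open>X\<close> enters \<open>v\<close> have distinct last arcs in \<open>X\<close>, and
  \<open>card X\<close> of them exhaust \<open>X\<close>.\<close>

lemma path_matroid_indep_iff:
  assumes "r \<in> verts G" "v \<in> verts G" "r \<noteq> v"
  shows "X \<in> path_matroid_indep G r v \<longleftrightarrow> X \<subseteq> in_arcs G v \<and>
    card X \<le> local_edge_connectivity (spanning_sub G ((arcs G - in_arcs G v) \<union> X)) r v"
proof (cases "X \<subseteq> in_arcs G v")
  case True
  let ?S = "(arcs G - in_arcs G v) \<union> X"
  have S: "?S \<subseteq> arcs G"
    using True by (auto simp: in_arcs_def)
  interpret S: fin_digraph "spanning_sub G ?S"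
    by (rule fin_digraph_spanning_sub[OF S])
  have finX: "finite X"
    by (rule finite_subset[OF True finite_in_arcs])
  have last_in: "last p \<in> set p" "last p \<in> in_arcs G v" if "apath r p v" for p
  proof -
    have "p \<noteq> []" using that assms by (auto simp: apath_Nil_iff)
    then show "last p \<in> set p" by simp
    then show "last p \<in> in_arcs G v"
      using that apath_head_iff_last[OF that \<open>p \<noteq> []\<close>] by (auto simp: apath_def awalk_def in_arcs_def)
  qed
  have "(\<exists>P. edge_disjoint_paths G r v P \<and> card P = card X \<and> last ` P = X)
    \<longleftrightarrow> card X \<le> local_edge_connectivity (spanning_sub G ?S) r v"
  proof
    assume "\<exists>P. edge_disjoint_paths G r v P \<and> card P = card X \<and> last ` P = X"
    then obtain P where P: "edge_disjoint_paths G r v P" "card P = card X" "last ` P = X"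
      by blast
    have "set p \<subseteq> ?S" if "p \<in> P" for p
    proof
      fix e assume e: "e \<in> set p"
      have p: "apath r p v"
        using P(1) that by (simp add: edge_disjoint_paths_def)
      then have "e \<in> arcs G" "head G e = v \<longrightarrow> e = last p"
        using e p apath_head_iff_last[OF p _ e] length_pos_if_in_set[OF e]
        by (auto simp: apath_def awalk_def)
      then show "e \<in> ?S"
        using P(3) that by (auto simp: in_arcs_def)
    qed
    then have "edge_disjoint_paths (spanning_sub G ?S) r v P"
      using P(1) by (simp add: edge_disjoint_paths_def apath_spanning_sub[OF S])
    then show "card X \<le> local_edge_connectivity (spanning_sub G ?S) r v"
      using S.card_le_local_edge_connectivity P(2) by metis
  next
    assume le: "card X \<le> local_edge_connectivity (spanning_sub G ?S) r v"
    obtain P where P: "edge_disjoint_paths (spanning_sub G ?S) r v P"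
        "card P = local_edge_connectivity (spanning_sub G ?S) r v"
      by (rule S.local_edge_connectivity_attained)
    have PG: "edge_disjoint_paths G r v P" and PS: "\<And>p. p \<in> P \<Longrightarrow> apath r p v \<and> set p \<subseteq> ?S"
      using P(1) by (auto simp: edge_disjoint_paths_def apath_spanning_sub[OF S])
    have lastX: "last ` P \<subseteq> X"
      using PS last_in by blast
    have "inj_on last P"
    proof (rule inj_onI)
      fix p q assume pq: "p \<in> P" "q \<in> P" "last p = last q"
      then have "last p \<in> set p \<inter> set q"
        using PS last_in(1) by (metis IntI)
      then show "p = q"
        using PG pq unfolding edge_disjoint_paths_def by blast
    qed
    then have "card (last ` P) = card P"
      by (rule card_image)
    then have "last ` P = X"
      using lastX le P(2) finX by (metis card_seteq)
    then show "\<exists>P. edge_disjoint_paths G r v P \<and> card P = card X \<and> last ` P = X"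
      using PG \<open>card (last ` P) = card P\<close> by metis
  qed
  then show ?thesis
    using True by (simp add: path_matroid_indep_def)
qed (simp add: path_matroid_indep_def)

text \<open>For a maximal \<open>B\<close>, every other arc \<open>e\<close> into \<open>v\<close> has its tail in some cut of size \<open>card B\<close> of the
  graph in which only the arcs of \<open>B\<close> enter \<open>v\<close>. The union of these cuts still has size \<open>card B\<close>, now
  even in \<open>G\<close>.\<close>

lemma card_base_path_matroid:
  assumes r: "r \<in> verts G" and v: "v \<in> verts G" "r \<noteq> v"
    and base: "base_of (path_matroid_indep G r v) B"
  shows "card B = local_edge_connectivity G r v"
proof (rule antisym)
  let ?S = "(arcs G - in_arcs G v) \<union> B"
  let ?d = "\<lambda>X. card (cut_arcs G ?S X)"
  have B: "B \<subseteq> in_arcs G v" "card B \<le> local_edge_connectivity (spanning_sub G ?S) r v"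
    using base unfolding base_of_def path_matroid_indep_iff[OF r v] by auto
  have S: "?S \<subseteq> arcs G" "finite ?S" and finB: "finite B"
    using B(1) finite_subset[OF B(1) finite_in_arcs] by (auto simp: in_arcs_def)
  show "card B \<le> local_edge_connectivity G r v"
    using B(2) local_edge_connectivity_mono[OF S(1) subset_refl r v] by simp
  define tight where "tight X \<longleftrightarrow> X \<subseteq> verts G \<and> v \<in> X \<and> r \<notin> X \<and> ?d X \<le> card B" for X
  have dB: "card B \<le> ?d X" if "X \<subseteq> verts G" "v \<in> X" "r \<notin> X" for X
    using B(2) that menger_spanning_sub[OF S(1) r v] by blast
  have tight_Un: "tight (X \<union> Y)" if "tight X" "tight Y" for X Y
  proof -
    have "card B \<le> ?d (X \<inter> Y)"
      by (rule dB) (use that in \<open>auto simp: tight_def\<close>)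
    then show ?thesis
      using that card_cut_arcs_submodular[OF S(2), of G X Y] unfolding tight_def by auto
  qed
  have cover: "\<exists>X. tight X \<and> tail G e \<in> X" if e: "e \<in> in_arcs G v - B" for e
  proof -
    have ins: "(arcs G - in_arcs G v) \<union> insert e B = insert e ?S"
      by blast
    have eS: "e \<notin> ?S" "insert e ?S \<subseteq> arcs G" "head G e = v"
      using e S by (auto simp: in_arcs_def)
    have "insert e B \<notin> path_matroid_indep G r v"
      using base e unfolding base_of_def by blast
    then have "\<not> Suc (card B) \<le> local_edge_connectivity (spanning_sub G (insert e ?S)) r v"
      using B(1) e finB unfolding path_matroid_indep_iff[OF r v] ins by auto
    then obtain X where X: "X \<subseteq> verts G" "v \<in> X" "r \<notin> X"
        "card (cut_arcs G (insert e ?S) X) \<le> card B"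
      using menger_spanning_sub[OF eS(2) r v] by (metis not_less_eq_eq)
    \<comment> \<open>At least \<open>card B\<close> arcs enter \<open>X\<close> already without
      \<open>e\<close>, so \<open>e\<close> cannot enter it; since \<open>v\<close> is in
      \<open>X\<close>, the tail must be too.\<close>
    then have "tail G e \<in> X" "tight X"
      using card_cut_arcs_insert[OF S(2) eS(1), of G X] dB[OF X(1-3)] eS(3)
      by (cases "tail G e \<in> X"; auto simp: tight_def)+
    then show ?thesis by blast
  qed
  \<comment> \<open>The union needs at least one tight set to start from, hence \<open>E\<close> is
    nonempty here; the remaining case is settled below by the cut \<open>{v}\<close>.\<close>
  have cover_all: "\<exists>X. X \<subseteq> verts G \<and> v \<in> X \<and> r \<notin> X \<and> ?d X \<le> card B \<and> tail G ` E \<subseteq> X"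
    if "finite E" "E \<noteq> {}" "E \<subseteq> in_arcs G v - B" for E
    using that
  proof (induction E rule: finite_ne_induct)
    case (singleton e)
    then show ?case using cover[of e] by (auto simp: tight_def)
  next
    case (insert e E)
    then obtain X Y where "tight X" "tail G ` E \<subseteq> X" "tight Y" "tail G e \<in> Y"
      using cover[of e] by (auto simp: tight_def)
    then have "tight (X \<union> Y)" "tail G ` insert e E \<subseteq> X \<union> Y"
      using tight_Un by auto
    then show ?case unfolding tight_def by blast
  qed
  show "local_edge_connectivity G r v \<le> card B"
  proof (cases "in_arcs G v - B = {}")
    case True
    have "local_edge_connectivity G r v \<le> card (cut_arcs G (arcs G) {v})"
      using menger[OF r v, of "local_edge_connectivity G r v"] v by blast
    also have "\<dots> \<le> card B"
      using True finB by (intro card_mono) (auto simp: cut_arcs_def in_arcs_def)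
    finally show ?thesis .
  next
    case False
    then obtain X where X: "X \<subseteq> verts G" "v \<in> X" "r \<notin> X" "?d X \<le> card B"
        "tail G ` (in_arcs G v - B) \<subseteq> X"
      using cover_all[of "in_arcs G v - B"] by (metis finite_Diff finite_in_arcs subset_refl)
    have "local_edge_connectivity G r v \<le> card (cut_arcs G (arcs G) X)"
      using menger[OF r v, of "local_edge_connectivity G r v"] X by blast
    \<comment> \<open>Every arc into \<open>v\<close> outside \<open>B\<close> has its tail in
      \<open>X\<close>, so restoring these arcs does not enlarge the cut.\<close>
    also have "\<dots> \<le> ?d X"
      using X(5) S(2) by (intro card_mono finite_cut_arcs) (auto simp: cut_arcs_def image_subset_iff)
    also have "\<dots> \<le> card B" by (rule X(4))
    finally show ?thesis .
  qed
qed

end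

section \<open>Deleting a sink\<close>

lemma del_vert_spanning_sub:
  assumes "F \<subseteq> arcs G" "out_arcs G t = {}"
  shows "pre_digraph.del_vert (spanning_sub G F) t
    = spanning_sub (pre_digraph.del_vert G t) (F - in_arcs G t)"
  using assms
  by (intro pre_digraph.equality) (auto simp: pre_digraph.del_vert_simps in_arcs_def out_arcs_def)

text \<open>A set avoiding \<open>t\<close> is entered by the same arcs in both graphs because no
  arc leaves \<open>t\<close>, and dropping \<open>t\<close> from a set yields a cut of
  \<open>del_vert t\<close> that is no larger.\<close>

lemma (in fin_digraph) local_edge_connectivity_del_sink:
  assumes "out_arcs G t = {}" "u \<in> verts G" "v \<in> verts G" "u \<noteq> v" "u \<noteq> t" "v \<noteq> t"
  shows "local_edge_connectivity (del_vert t) u v = local_edge_connectivity G u v"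
proof -
  interpret H: fin_digraph "del_vert t" by (rule fin_digraph_del_vert)
  let ?d = "\<lambda>X. card (cut_arcs G (arcs G) X)"
  let ?dt = "\<lambda>X. card (cut_arcs (del_vert t) (arcs (del_vert t)) X)"
  have eq: "cut_arcs (del_vert t) (arcs (del_vert t)) X = cut_arcs G (arcs G) X" if "t \<notin> X" for X
    using that assms(1) by (auto simp: cut_arcs_def del_vert_simps out_arcs_def)
  have le: "?dt (X - {t}) \<le> ?d X" for X
    by (intro card_mono finite_cut_arcs) (auto simp: cut_arcs_def del_vert_simps)
  have "k \<le> local_edge_connectivity (del_vert t) u v \<longleftrightarrow> k \<le> local_edge_connectivity G u v" for k
  proof -
    have "(\<forall>X\<subseteq>verts G - {t}. v \<in> X \<longrightarrow> u \<notin> X \<longrightarrow> k \<le> ?dt X)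
      \<longleftrightarrow> (\<forall>X\<subseteq>verts G. v \<in> X \<longrightarrow> u \<notin> X \<longrightarrow> k \<le> ?d X)" (is "?L \<longleftrightarrow> ?R")
    proof
      assume L: ?L
      show ?R
      proof (intro allI impI)
        fix X assume "X \<subseteq> verts G" "v \<in> X" "u \<notin> X"
        then have "X - {t} \<subseteq> verts G - {t}" "v \<in> X - {t}" "u \<notin> X - {t}"
          using assms(6) by auto
        then have "k \<le> ?dt (X - {t})"
          using L by blast
        then show "k \<le> ?d X" by (rule order_trans[OF _ le])
      qed
    next
      assume R: ?R
      show ?L
      proof (intro allI impI)
        fix X assume "X \<subseteq> verts G - {t}" "v \<in> X" "u \<notin> X"
        then show "k \<le> ?dt X" using R by (subst eq) auto
      qed
    qed
    moreover have "u \<in> verts (del_vert t)" "v \<in> verts (del_vert t)"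
      using assms by (simp_all add: verts_del_vert)
    ultimately show ?thesis
      unfolding menger[OF assms(2-4)] by (simp only: H.menger[OF _ _ assms(4)] verts_del_vert)
  qed
  then show ?thesis by (meson antisym order_refl)
qed

text \<open>Arcs into a sink affect neither connectivity nor in-degree at the other vertices, so
  those conditions are the ones in \<open>del_vert t\<close>, and only the two equations at
  \<open>t\<close> remain.\<close>

lemma (in fin_digraph) maximal_flame_sink:
  assumes sink: "out_arcs G t = {}" and r: "r \<in> verts G" and t: "t \<in> verts G" "r \<noteq> t"
    and F: "F \<subseteq> arcs G"
  shows "maximal_flame G r F \<longleftrightarrow>
    maximal_flame (del_vert t) r (F - in_arcs G t) \<and>
    local_edge_connectivity G r t = local_edge_connectivity (spanning_sub G F) r t \<and>
    local_edge_connectivity (spanning_sub G F) r t = card (F \<inter> in_arcs G t)"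
proof -
  interpret F: fin_digraph "spanning_sub G F"
    by (rule fin_digraph_spanning_sub[OF F])
  have sinkF: "out_arcs (spanning_sub G F) t = {}"
    using sink F by (auto simp: out_arcs_def)
  have F': "F - in_arcs G t \<subseteq> arcs (del_vert t)"
    using F sink by (auto simp: del_vert_simps in_arcs_def out_arcs_def)
  have conn: "local_edge_connectivity (del_vert t) r v = local_edge_connectivity G r v"
    "local_edge_connectivity (spanning_sub (del_vert t) (F - in_arcs G t)) r v
      = local_edge_connectivity (spanning_sub G F) r v"
    "in_degree (spanning_sub (del_vert t) (F - in_arcs G t)) v = in_degree (spanning_sub G F) v"
    if "v \<in> verts G - {r}" "v \<noteq> t" for v
  proof -
    show "local_edge_connectivity (del_vert t) r v = local_edge_connectivity G r v"
      using local_edge_connectivity_del_sink[OF sink r] that t by auto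
    show "local_edge_connectivity (spanning_sub (del_vert t) (F - in_arcs G t)) r v
        = local_edge_connectivity (spanning_sub G F) r v"
      using F.local_edge_connectivity_del_sink[OF sinkF, of r v] that t r
      by (auto simp: del_vert_spanning_sub[OF F sink])
    have "{e \<in> F - in_arcs G t. head G e = v} = {e \<in> F. head G e = v}"
      using that by (auto simp: in_arcs_def)
    then show "in_degree (spanning_sub (del_vert t) (F - in_arcs G t)) v
        = in_degree (spanning_sub G F) v"
      by (simp add: in_degree_spanning_sub del_vert_simps)
  qed
  have deg: "in_degree (spanning_sub G F) t = card (F \<inter> in_arcs G t)"
    using F unfolding in_degree_spanning_sub by (intro arg_cong[of _ _ card]) (auto simp: in_arcs_def)
  have split: "verts G - {r} = insert t (verts G - {t} - {r})"
    using t by auto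
  have "(\<forall>v\<in>verts G - {t} - {r}.
      local_edge_connectivity (del_vert t) r v
        = local_edge_connectivity (spanning_sub (del_vert t) (F - in_arcs G t)) r v \<and>
      local_edge_connectivity (spanning_sub (del_vert t) (F - in_arcs G t)) r v
        = in_degree (spanning_sub (del_vert t) (F - in_arcs G t)) v) \<longleftrightarrow>
    (\<forall>v\<in>verts G - {t} - {r}.
      local_edge_connectivity G r v = local_edge_connectivity (spanning_sub G F) r v \<and>
      local_edge_connectivity (spanning_sub G F) r v = in_degree (spanning_sub G F) v)"
    by (rule ball_cong) (simp_all add: conn)
  then show ?thesis
    unfolding maximal_flame_def split verts_del_vert ball_simps deg using F F' by blast
qed

section \<open>Decomposition of maximal flames at a sink\<close>

theorem theorem3:
  fixes D :: "('a, 'b) pre_digraph" and V :: "'a set" and r t :: 'a and F :: "'b set"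
  assumes "fin_digraph D"
    and "verts D = insert r V" and "r \<notin> V"
    and "t \<in> V" and "out_arcs D t = {}"
    and "F \<subseteq> arcs D"
  shows "maximal_flame D r F \<longleftrightarrow>
    (\<exists>F' B. maximal_flame (pre_digraph.del_vert D t) r F' \<and>
            base_of (path_matroid_indep D r t) B \<and>
            F' \<inter> B = {} \<and> F = F' \<union> B)"
proof -
  interpret D: fin_digraph D by fact
  interpret H: fin_digraph "D.del_vert t" by (rule D.fin_digraph_del_vert)
  have r: "r \<in> verts D" and t: "t \<in> verts D" "r \<noteq> t"
    using assms by auto
  let ?in = "in_arcs D t"
  have arcsH: "arcs (D.del_vert t) = arcs D - ?in"
    using assms(5) by (auto simp: D.del_vert_simps in_arcs_def out_arcs_def)
  note iff = D.maximal_flame_sink[OF assms(5) r t assms(6)]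
  show ?thesis
  proof
    assume flame: "maximal_flame D r F"
    let ?B = "F \<inter> ?in"
    have B: "local_edge_connectivity D r t = card ?B"
        "local_edge_connectivity (spanning_sub D F) r t = card ?B"
      using flame unfolding iff by auto
    \<comment> \<open>Restoring all arcs that do not enter \<open>t\<close> cannot lower the
      connectivity to \<open>t\<close>, which is already \<open>card ?B\<close> in
      \<open>F\<close>.\<close>
    have "F \<subseteq> arcs D - ?in \<union> ?B" "arcs D - ?in \<union> ?B \<subseteq> arcs D"
      using assms(6) by auto
    then have "?B \<in> path_matroid_indep D r t"
      using D.local_edge_connectivity_mono[OF _ _ r t] B(2)
      unfolding D.path_matroid_indep_iff[OF r t] by (metis Int_lower2)
    \<comment> \<open>No independent set is larger than the connectivity from \<open>r\<close> to
      \<open>t\<close> in \<open>D\<close>, and \<open>?B\<close> attains this bound.\<close>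
    moreover have "X = ?B" if X: "X \<in> path_matroid_indep D r t" "?B \<subseteq> X" for X
    proof -
      have Xin: "X \<subseteq> ?in"
        and le: "card X \<le> local_edge_connectivity (spanning_sub D (arcs D - ?in \<union> X)) r t"
        using X(1) unfolding D.path_matroid_indep_iff[OF r t] by auto
      have SX: "arcs D - ?in \<union> X \<subseteq> arcs D"
        using Xin by (auto simp: in_arcs_def)
      have "card X \<le> card ?B"
        using le B(1) D.local_edge_connectivity_mono[OF SX subset_refl r t] by simp
      moreover have "finite X"
        by (rule finite_subset[OF Xin D.finite_in_arcs])
      ultimately show ?thesis
        using card_seteq[OF _ X(2)] by simp
    qed
    ultimately have "base_of (path_matroid_indep D r t) ?B"
      unfolding base_of_def by blast
    moreover have "maximal_flame (D.del_vert t) r (F - ?in)"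
      using flame unfolding iff by blast
    ultimately show "\<exists>F' B. maximal_flame (D.del_vert t) r F' \<and>
        base_of (path_matroid_indep D r t) B \<and> F' \<inter> B = {} \<and> F = F' \<union> B"
      by (intro exI[of _ "F - ?in"] exI[of _ ?B]) auto
  next
    assume "\<exists>F' B. maximal_flame (D.del_vert t) r F' \<and>
        base_of (path_matroid_indep D r t) B \<and> F' \<inter> B = {} \<and> F = F' \<union> B"
    then obtain F' B where F': "maximal_flame (D.del_vert t) r F'"
      and B: "base_of (path_matroid_indep D r t) B" and FB: "F = F' \<union> B"
      by blast
    have F'_sub: "F' \<subseteq> arcs (D.del_vert t)"
      using F' unfolding maximal_flame_def by blast
    let ?S = "arcs D - ?in \<union> B"
    have B_in: "B \<subseteq> ?in" and B_le: "card B \<le> local_edge_connectivity (spanning_sub D ?S) r t"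
      using B unfolding base_of_def D.path_matroid_indep_iff[OF r t] by auto
    have F'_eq: "F - ?in = F'" and B_eq: "F \<inter> ?in = B"
      using F'_sub B_in FB unfolding arcsH by auto
    have S: "?S \<subseteq> arcs D" using B_in by (auto simp: in_arcs_def)
    have finB: "finite B" and finF': "finite F'"
      by (rule finite_subset[OF B_in D.finite_in_arcs], rule finite_subset[OF F'_sub H.finite_arcs])
    have card_B: "card B = local_edge_connectivity D r t"
      by (rule D.card_base_path_matroid[OF r t B])
    \<comment> \<open>As \<open>card B\<close> is the connectivity in \<open>D\<close>, both
      equations at \<open>t\<close> follow once no cut of \<open>F\<close> around \<open>t\<close>
      is smaller than \<open>card B\<close>.\<close>
    have "card B \<le> card (cut_arcs D F Y)" if Y: "Y \<subseteq> verts D" "t \<in> Y" "r \<notin> Y" for Y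
    proof -
      have rH: "r \<in> verts (D.del_vert t)" and YH: "Y - {t} \<subseteq> verts (D.del_vert t) - {r}"
        using r t Y by (auto simp: D.del_vert_simps)
      \<comment> \<open>\<open>F'\<close> preserves connectivity in the graph without
        \<open>t\<close>, so \<open>Y - {t}\<close> can be enlarged there to a set whose full
        in-degree is bounded by its in-degree in \<open>F'\<close>.\<close>
      obtain Z where Z: "Y - {t} \<subseteq> Z" "Z \<subseteq> verts (D.del_vert t) - {r}"
          "card (cut_arcs (D.del_vert t) (arcs (D.del_vert t)) Z)
            \<le> card (cut_arcs (D.del_vert t) F' (Y - {t}))"
        by (rule H.cut_of_connectivity_preserving_subgraph[OF rH F'_sub _ YH])
          (use F' in \<open>auto simp: maximal_flame_def\<close>)
      let ?CZ = "cut_arcs (D.del_vert t) (arcs (D.del_vert t)) Z"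
      let ?CY = "cut_arcs (D.del_vert t) F' (Y - {t})"
      let ?BY = "{e \<in> B. tail D e \<notin> Y}"
      have no_t: "tail D e \<noteq> t" if "e \<in> arcs D" for e
        using assms(5) that by (auto simp: out_arcs_def)
      have "insert t Z \<subseteq> verts D" "r \<notin> insert t Z"
        using Z(2) t by (auto simp: D.del_vert_simps)
      then have "card B \<le> card (cut_arcs D ?S (insert t Z))"
        using B_le D.menger_spanning_sub[OF S r t] by blast
      \<comment> \<open>Arcs entering \<open>insert t Z\<close> either enter \<open>Z\<close> in the
        graph without \<open>t\<close> or lie in \<open>B\<close>; the latter start outside
        \<open>Y\<close>, because \<open>Y\<close> is contained in
        \<open>insert t Z\<close>.\<close>
      also have "\<dots> \<le> card (?CZ \<union> ?BY)"
        using Z(1) B_in no_t finB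
        by (intro card_mono finite_UnI finite_cut_arcs)
          (auto simp: cut_arcs_def D.del_vert_simps in_arcs_def)
      also have "\<dots> \<le> card ?CZ + card ?BY"
        by (rule card_Un_le)
      also have "\<dots> \<le> card ?CY + card ?BY"
        using Z(3) by simp
      \<comment> \<open>The two sets are disjoint because \<open>B\<close> consists of arcs into
        \<open>t\<close> and \<open>F'\<close> contains none.\<close>
      also have "\<dots> = card (?CY \<union> ?BY)"
        using F'_sub B_in finB finF'
        by (intro card_Un_disjoint[symmetric]) (auto simp: cut_arcs_def arcsH)
      \<comment> \<open>No arc starts at \<open>t\<close>, so arcs of \<open>F'\<close> that enter
        \<open>Y - {t}\<close> also enter \<open>Y\<close>; arcs of \<open>B\<close> starting
        outside \<open>Y\<close> enter it at \<open>t\<close>.\<close>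
      also have "\<dots> \<le> card (cut_arcs D F Y)"
        using FB F'_sub B_in no_t Y(2) finB finF'
        by (intro card_mono finite_cut_arcs)
          (auto simp: cut_arcs_def D.del_vert_simps in_arcs_def)
      finally show ?thesis .
    qed
    then have "card B \<le> local_edge_connectivity (spanning_sub D F) r t"
      using D.menger_spanning_sub[OF assms(6) r t] by blast
    moreover have "local_edge_connectivity (spanning_sub D F) r t \<le> local_edge_connectivity D r t"
      using D.local_edge_connectivity_mono[OF assms(6) subset_refl r t] by simp
    ultimately show "maximal_flame D r F"
      unfolding iff F'_eq B_eq using F' card_B by simp
  qed
qed

end
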